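(* Let $1\le k\le n$. Let $h^*$ be the estimator that draws $k$ random orthogonal unit vectors $x_1,\dots,x_k\in\mathbb{R}^n$ and outputs $\frac{n}{k}\sum_{i=1}^k f_A(x_i)$. Then, among all linear nonadaptive unbiased trace estimators that make $k$ queries, $h^*$ is a minimum variance unbiased estimator: $h^*$ is a linear nonadaptive unbiased trace estimator, and $\mathrm{Var}(h^* )\le \mathrm{Var}(h)$ for every linear nonadaptive unbiased trace estimator $h$ making $k$ queries.
   Context: For an unknown real $n\times n$ matrix $A$, the oracle is $f_A(x)=x^TAx$ for $x\in\mathbb{R}^n$. A trace estimator making $k$ queries is a randomized algorithm that chooses queries $x_1,\dots,x_k\in\mathbb{R}^n$, receives $f_A(x_1),\dots,f_A(x_k)$, and outputs a real number $h(A)$ determined by the queries and answers. It is nonadaptive if the distribution of $x_i$ does not depend on $f_A(x_1),\dots,f_A(x_{i-1})$. It is linear if it samples from some joint distribution a tuple of queries $(x_1,\dots,x_k)$ together with weights $(w_1,\dots,w_k)\in\mathbb{R}^k$ and outputs $\sum_i w_i f_A(x_i)$; it is unbiased if $\mathbb{E}[\sum_i w_if_A(x_i)]=\mathrm{trace}(A)$ for every $A$. For an estimator $h$ and matrix $A$, $\mathrm{Var}(A,h)=\mathbb{E}[(h(A)-\mathrm{trace}(A))^2]$ (expectation over the internal randomness of $h$), and $\mathrm{Var}(h)=\sup_{\|A\|_F=1}\mathrm{Var}(A,h)$, where $\|A\|_F=\sqrt{\mathrm{trace}(A^TA)}$. A random orthogonal matrix is an $n\times n$ orthogonal matrix drawn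 from the Haar probability measure on the orthogonal group; $k$ random orthogonal unit vectors are $k$ rows of a random orthogonal matrix. *)

theory Defs
  imports "HOL-Probability.Probability"
begin

definition quad_form :: "real^'n^'n \<Rightarrow> real^'n \<Rightarrow> real" where
  "quad_form A x = x \<bullet> (A *v x)"

definition frobenius_norm :: "real^'n^'n \<Rightarrow> real" where
  "frobenius_norm A = sqrt (trace (transpose A ** A))"

text \<open>
  A randomized query algorithm. All internal randomness is a seed \<open>s\<close> drawn from the
  probability space \<open>seed h\<close>; \<open>query h i s a\<close> is the \<open>i\<close>-th query (counting from 0) when
  the earlier answers are \<open>a 0, \<dots>, a (i - 1)\<close>, and \<open>result h s a\<close> is the value returned
  once all answers are known. As the result may use the seed, it may depend on the queries
  and on further randomness, such as random weights.
\<close>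

record ('s, 'n::finite) query_alg =
  seed :: "'s measure"
  query :: "nat \<Rightarrow> 's \<Rightarrow> (nat \<Rightarrow> real) \<Rightarrow> real^'n"
  result :: "'s \<Rightarrow> (nat \<Rightarrow> real) \<Rightarrow> real"

text \<open>
  Tuples of \<open>i\<close> answers are the points of \<open>\<Pi>\<^sub>M j\<in>{..<i}. borel\<close>, i.e. functions that are
  \<open>undefined\<close> outside \<open>{..<i}\<close>.
\<close>

definition trace_estimator :: "nat \<Rightarrow> ('s, 'n::finite) query_alg \<Rightarrow> bool" where
  "trace_estimator k h \<longleftrightarrow>
     prob_space (seed h) \<and>
     (\<forall>i<k. (\<lambda>(s, a). query h i s a)
              \<in> seed h \<Otimes>\<^sub>M (\<Pi>\<^sub>M j\<in>{..<i}. borel) \<rightarrow>\<^sub>M borel) \<and>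
     (\<lambda>(s, a). result h s a) \<in> seed h \<Otimes>\<^sub>M (\<Pi>\<^sub>M j\<in>{..<k}. borel) \<rightarrow>\<^sub>M borel"

primrec answers ::
  "('s, 'n::finite) query_alg \<Rightarrow> real^'n^'n \<Rightarrow> 's \<Rightarrow> nat \<Rightarrow> nat \<Rightarrow> real" where
  "answers h A s 0 = (\<lambda>_. undefined)"
| "answers h A s (Suc i) =
     (answers h A s i)(i := quad_form A (query h i s (answers h A s i)))"

definition estimate ::
  "nat \<Rightarrow> ('s, 'n::finite) query_alg \<Rightarrow> real^'n^'n \<Rightarrow> 's \<Rightarrow> real" where
  "estimate k h A s = result h s (answers h A s k)"

text \<open>
  Nonadaptivity concerns the law of the whole query tuple under fixed answers: looking only
  at each single query's law would admit a rotation-invariant first query followed by an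
  answer-dependent rotation of it.
\<close>

definition nonadaptive :: "nat \<Rightarrow> ('s, 'n::finite) query_alg \<Rightarrow> bool" where
  "nonadaptive k h \<longleftrightarrow>
     (\<forall>a b. distr (seed h) (\<Pi>\<^sub>M i\<in>{..<k}. borel)
              (\<lambda>s. \<lambda>i\<in>{..<k}. query h i s (restrict a {..<i}))
          = distr (seed h) (\<Pi>\<^sub>M i\<in>{..<k}. borel)
              (\<lambda>s. \<lambda>i\<in>{..<k}. query h i s (restrict b {..<i})))"

definition linear_estimator :: "nat \<Rightarrow> ('s, 'n::finite) query_alg \<Rightarrow> bool" where
  "linear_estimator k h \<longleftrightarrow>
     (\<exists>x w. (\<forall>i<k. x i \<in> seed h \<rightarrow>\<^sub>M borel) \<and>
            (\<forall>i<k. w i \<in> borel_measurable (seed h)) \<and>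
            (\<forall>i<k. \<forall>s\<in>space (seed h). \<forall>a\<in>space (\<Pi>\<^sub>M j\<in>{..<i}. borel).
               query h i s a = x i s) \<and>
            (\<forall>s\<in>space (seed h). \<forall>a\<in>space (\<Pi>\<^sub>M j\<in>{..<k}. borel).
               result h s a = (\<Sum>i<k. w i s * a i)))"

definition unbiased :: "nat \<Rightarrow> ('s, 'n::finite) query_alg \<Rightarrow> bool" where
  "unbiased k h \<longleftrightarrow>
     (\<forall>A. integrable (seed h) (estimate k h A) \<and>
          integral\<^sup>L (seed h) (estimate k h A) = trace A)"

text \<open>Variances are extended nonnegative reals, as they may be infinite.\<close>

definition variance_at ::
  "nat \<Rightarrow> real^'n^'n \<Rightarrow> ('s, 'n::finite) query_alg \<Rightarrow> ennreal" where
  "variance_at k A h = (\<integral>\<^sup>+s. ennreal ((estimate k h A s - trace A)\<^sup>2) \<partial>seed h)"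

definition worst_variance :: "nat \<Rightarrow> ('s, 'n::finite) query_alg \<Rightarrow> ennreal" where
  "worst_variance k h = (SUP A\<in>{A. frobenius_norm A = 1}. variance_at k A h)"

definition haar_orthogonal :: "(real^'n^'n) measure \<Rightarrow> bool" where
  "haar_orthogonal \<mu> \<longleftrightarrow>
     sets \<mu> = sets (restrict_space borel {U. orthogonal_matrix U}) \<and>
     prob_space \<mu> \<and>
     (\<forall>Q. orthogonal_matrix Q \<longrightarrow> distr \<mu> \<mu> (\<lambda>U. Q ** U) = \<mu>)"

text \<open>
  The injection \<open>r\<close> (on \<open>{..<k}\<close>) says which \<open>k\<close> rows of the random orthogonal matrix serve
  as queries.
\<close>

definition hstar ::
  "(real^'n^'n) measure \<Rightarrow> (nat \<Rightarrow> 'n) \<Rightarrow> nat \<Rightarrow> (real^'n^'n, 'n::finite) query_alg" where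
  "hstar \<mu> r k =
     \<lparr> seed = \<mu>,
       query = (\<lambda>i U _. row (r i) U),
       result = (\<lambda>_ a. real CARD('n) / real k * (\<Sum>i<k. a i)) \<rparr>"

end

theory Submission
  imports Defs
begin

text \<open>
  A linear estimator with queries \<open>x\<^sub>i\<close> and weights \<open>w\<^sub>i\<close> computes the Frobenius inner product of \<open>A\<close>
  with the random symmetric matrix \<open>M = \<Sum> w\<^sub>i x\<^sub>i x\<^sub>i\<^sup>T\<close> of rank at most \<open>k\<close>. The worst variance is at
  least the average over a tight frame of traceless symmetric matrices, which is governed by
  \<open>\<parallel>M\<parallel>\<^sup>2 - (trace M)\<^sup>2 / n \<ge> (1/k - 1/n) (trace M)\<^sup>2\<close>; as \<open>trace M\<close> has expectation \<open>n\<close>, this gives a lower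
  bound that depends on \<open>n\<close> and \<open>k\<close> only. For \<open>h\<^sup>*\<close> the matrix \<open>M\<close> is \<open>n/k\<close> times a uniformly random
  projection \<open>P\<close> of rank \<open>k\<close>. By invariance, \<open>E[P\<^sub>i\<^sub>j P\<^sub>l\<^sub>m] = \<beta> \<delta>\<^sub>i\<^sub>j \<delta>\<^sub>l\<^sub>m + \<gamma> (\<delta>\<^sub>i\<^sub>l \<delta>\<^sub>j\<^sub>m + \<delta>\<^sub>i\<^sub>m \<delta>\<^sub>j\<^sub>l)\<close>,
  and \<open>trace P = \<parallel>P\<parallel>\<^sup>2 = k\<close> determines \<open>\<beta>\<close> and \<open>\<gamma>\<close>, so the variance is the same in all traceless
  symmetric directions and vanishes at the identity: the lower bound is attained.
\<close>


section \<open>Rank-one matrices, the Frobenius inner product and the trace-rank inequality\<close>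

definition outer :: "real^'n \<Rightarrow> real^'n \<Rightarrow> real^'n^'n" where
  "outer x y = (\<chi> i j. x $ i * y $ j)"

lemma inner_mat_1: "A \<bullet> mat 1 = trace (A :: real^'n^'n)"
  by (simp add: inner_vec_def trace_def mat_def mult_delta_right if_distrib cong: if_cong)

lemma inner_outer: "outer x y \<bullet> A = x \<bullet> (A *v y)"
  by (simp add: inner_vec_def outer_def matrix_vector_mult_def sum_distrib_left algebra_simps)

lemma quad_form_outer: "quad_form A x = outer x x \<bullet> A"
  by (simp add: quad_form_def inner_outer)

lemma inner_outer_outer: "outer x y \<bullet> outer u v = (x \<bullet> u) * (y \<bullet> v)"
  by (simp add: inner_vec_def outer_def sum_product algebra_simps)

lemma trace_outer: "trace (outer x y) = x \<bullet> y"
  by (simp add: trace_def outer_def inner_vec_def)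

lemma trace_sum: "trace (\<Sum>i\<in>I. f i) = (\<Sum>i\<in>I. trace (f i :: real^'n^'n))"
  by (simp add: inner_sum_left flip: inner_mat_1)

lemma trace_scaleR: "trace (c *\<^sub>R A) = c * trace (A :: real^'n^'n)"
  by (simp flip: inner_mat_1)

lemma frobenius_norm_eq: "frobenius_norm A = norm A"
proof -
  have "trace (transpose A ** A) = A \<bullet> A"
    by (simp add: inner_vec_def trace_def matrix_matrix_mult_def transpose_def) (rule sum.swap)
  then show ?thesis by (simp add: frobenius_norm_def norm_eq_sqrt_inner)
qed

text \<open>Orthonormal vectors give orthonormal rank-one matrices, so the squared norm of this
  projection is its rank. Used for the projection in the rank inequality and later for the row
  projections.\<close>

lemma inner_sum_outer_orthonormal:
  assumes "finite I" and e: "\<And>i j. i \<in> I \<Longrightarrow> j \<in> I \<Longrightarrow> e i \<bullet> e j = (if i = j then 1 else 0)"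
  shows "(\<Sum>i\<in>I. outer (e i) (e i)) \<bullet> (\<Sum>i\<in>I. outer (e i) (e i)) = real (card I)"
proof -
  have "(\<Sum>i\<in>I. outer (e i) (e i)) \<bullet> (\<Sum>i\<in>I. outer (e i) (e i))
      = (\<Sum>i\<in>I. \<Sum>j\<in>I. if i = j then 1 else 0)"
    unfolding inner_sum_left inner_sum_right inner_outer_outer
    by (intro sum.cong refl) (simp add: e)
  also have "\<dots> = real (card I)"
    using assms(1) by simp
  finally show ?thesis .
qed

text \<open>
  With \<open>P\<close> the orthogonal projection onto the span of the \<open>x i\<close>, the trace of \<open>M\<close> is the
  Frobenius inner product of \<open>M\<close> and \<open>P\<close>, and \<open>P\<close> has squared norm at most \<open>k\<close>.
\<close>

lemma trace_sq_le_rank_inner: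
  fixes x :: "nat \<Rightarrow> real^'n" and w :: "nat \<Rightarrow> real" and k :: nat
  defines "M \<equiv> \<Sum>i<k. w i *\<^sub>R outer (x i) (x i)"
  shows "(trace M)\<^sup>2 \<le> real k * (M \<bullet> M)"
proof -
  define S where "S = span (x ` {..<k})"
  have "subspace S" by (simp add: S_def)
  from orthonormal_basis_subspace[OF this] obtain B where B: "B \<subseteq> S" "pairwise orthogonal B"
    "\<And>b. b \<in> B \<Longrightarrow> norm b = 1" "independent B" "card B = dim S" "span B = S" by metis
  have fin: "finite B" using B(4) by (rule independent_imp_finite)
  have on: "a \<bullet> b = (if a = b then 1 else 0)" if "a \<in> B" "b \<in> B" for a b
    using B(2,3) that by (auto simp: pairwise_def orthogonal_def dot_square_norm)
  define P where "P = (\<Sum>b\<in>B. outer b b)"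
  have "card B \<le> card (x ` {..<k})"
    unfolding B(5) S_def by (simp add: dim_le_card')
  also have "\<dots> \<le> k" by (metis card_image_le card_lessThan finite_lessThan)
  finally have PP: "P \<bullet> P \<le> real k"
    using inner_sum_outer_orthonormal[OF fin, of "\<lambda>b. b"] on by (simp add: P_def)
  \<comment> \<open>Parseval in \<open>B\<close>: since \<open>x i\<close> lies in the span of
    \<open>B\<close>, the projection \<open>P\<close> fixes it.\<close>
  have xx: "x i \<bullet> x i = outer (x i) (x i) \<bullet> P" if "i < k" for i
  proof -
    have "x i \<in> span B" using that by (simp add: B(6) S_def span_base)
    then have "(\<Sum>b\<in>B. (b \<bullet> x i) *\<^sub>R b) = x i"
      using orthonormal_basis_expand[OF B(2,3) _ fin] by (simp add: inner_commute[of _ "x i"])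
    then have "x i \<bullet> x i = x i \<bullet> (\<Sum>b\<in>B. (b \<bullet> x i) *\<^sub>R b)" by simp
    also have "\<dots> = outer (x i) (x i) \<bullet> P"
      unfolding P_def by (simp add: inner_sum_right inner_outer_outer inner_commute)
    finally show ?thesis .
  qed
  have "trace M = M \<bullet> P"
    unfolding M_def trace_sum inner_sum_left
    by (intro sum.cong refl) (simp add: trace_scaleR trace_outer xx)
  then have "(trace M)\<^sup>2 \<le> (M \<bullet> M) * (P \<bullet> P)"
    by (simp add: Cauchy_Schwarz_ineq)
  also have "\<dots> \<le> (M \<bullet> M) * real k" by (intro mult_left_mono PP) simp
  finally show ?thesis by (simp add: mult.commute)
qed

section \<open>A tight frame of the traceless symmetric matrices\<close>

text \<open>
  The matrices \<open>frame i j\<close> are the orthogonal projections of the matrix units onto the traceless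
  symmetric matrices, and therefore form a tight frame there.
\<close>

definition frame :: "'n \<Rightarrow> 'n \<Rightarrow> real^'n^'n" where
  "frame i j = (\<chi> l m. ((if l = i \<and> m = j then 1 else 0) + (if l = j \<and> m = i then 1 else 0)) / 2
     - (if i = j \<and> l = m then 1 / real CARD('n) else 0))"

lemma trace_frame: "trace (frame i j :: real^'n^'n) = 0"
  by (cases "i = j") (auto simp: trace_def frame_def sum_subtractf sum.distrib cong: if_cong conj_cong)

lemma inner_frame:
  fixes M :: "real^'n^'n"
  assumes "\<And>i j. M $ i $ j = M $ j $ i"
  shows "M \<bullet> frame i j = M $ i $ j - (if i = j then trace M / real CARD('n) else 0)"
proof -
  have "M \<bullet> frame i j = (\<Sum>l\<in>UNIV. \<Sum>m\<in>UNIV.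
      (if m = j then if l = i then M $ l $ m / 2 else 0 else 0)
      + (if m = i then if l = j then M $ l $ m / 2 else 0 else 0)
      - (if l = m then if i = j then M $ l $ m / real CARD('n) else 0 else 0))"
    unfolding inner_vec_def frame_def by (intro sum.cong refl) (auto simp: right_diff_distrib)
  also have "\<dots> = M $ i $ j / 2 + M $ j $ i / 2 - (if i = j then trace M / real CARD('n) else 0)"
    by (simp add: sum_subtractf sum.distrib trace_def sum_divide_distrib if_distrib[of "sum _"]
       if_distribR cong: if_cong)
  finally show ?thesis using assms[of j i] by simp
qed

lemma frame_sym: "frame i j $ l $ m = frame i j $ m $ l"
  by (auto simp: frame_def)

text \<open>Parseval for the tight frame: the right side is the squared norm of the traceless part
  of \<open>M\<close>, that is, of \<open>M\<close> minus trace M / n times the identity.\<close>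

lemma sum_inner_frame_sq:
  fixes M :: "real^'n^'n"
  assumes "\<And>i j. M $ i $ j = M $ j $ i"
  shows "(\<Sum>i\<in>UNIV. \<Sum>j\<in>UNIV. (M \<bullet> frame i j)\<^sup>2) = M \<bullet> M - (trace M)\<^sup>2 / real CARD('n)"
proof -
  let ?t = "trace M / real CARD('n)"
  have "(\<Sum>i\<in>UNIV. \<Sum>j\<in>UNIV. (M \<bullet> frame i j)\<^sup>2)
     = (\<Sum>i\<in>UNIV. \<Sum>j\<in>UNIV. (M $ i $ j)\<^sup>2 + (if i = j then ?t\<^sup>2 - 2 * ?t * M $ i $ j else 0))"
    unfolding inner_frame[OF assms] by (intro sum.cong refl) (auto simp: power2_eq_square algebra_simps)
  also have "\<dots> = M \<bullet> M + (real CARD('n) * ?t\<^sup>2 - 2 * ?t * trace M)"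
    by (simp add: sum.distrib sum_subtractf inner_vec_def power2_eq_square trace_def sum_distrib_left)
  also have "real CARD('n) * ?t\<^sup>2 - 2 * ?t * trace M = - ((trace M)\<^sup>2 / real CARD('n))"
    by (simp add: power2_eq_square field_simps)
  finally show ?thesis by simp
qed

text \<open>The squared norms of a Parseval frame add up to the dimension of the space, here that of
  the traceless symmetric matrices.\<close>

lemma sum_frame_sq:
  "(\<Sum>i\<in>UNIV. \<Sum>j\<in>UNIV. (norm (frame i j :: real^'n^'n))\<^sup>2)
     = real CARD('n) * (real CARD('n) + 1) / 2 - 1"
proof -
  let ?n = "real CARD('n)"
  have "(norm (frame i j :: real^'n^'n))\<^sup>2 = 1/2 + (if i = j then 1/2 - 1 / ?n else 0)" for i j :: 'n
    unfolding power2_norm_eq_inner inner_frame[OF frame_sym] trace_frame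
    by (simp add: frame_def)
  then have "(\<Sum>i\<in>UNIV. \<Sum>j\<in>UNIV. (norm (frame i j :: real^'n^'n))\<^sup>2)
      = (\<Sum>i\<in>UNIV. \<Sum>j\<in>(UNIV :: 'n set). 1/2 + (if i = j then 1/2 - 1 / ?n else 0))"
    by simp
  also have "\<dots> = ?n * (?n + 1) / 2 - 1"
    by (simp add: sum.distrib) (simp add: field_simps)
  finally show ?thesis .
qed


section \<open>Haar measure: invariance under transposition and right multiplication\<close>

lemma continuous_on_matrix_mult [continuous_intros]:
  fixes f g :: "'a::topological_space \<Rightarrow> real^'n^'n"
  assumes "continuous_on S f" "continuous_on S g"
  shows "continuous_on S (\<lambda>x. f x ** g x)"
  unfolding matrix_matrix_mult_def by (intro continuous_intros assms)

lemma continuous_on_transpose [continuous_intros]: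
  fixes f :: "'a::topological_space \<Rightarrow> real^'n^'m"
  assumes "continuous_on S f"
  shows "continuous_on S (\<lambda>x. transpose (f x))"
  unfolding transpose_def by (intro continuous_intros assms)

text \<open>Only left invariance is assumed; the moments of the row projections use right
  invariance, which \<open>distr_right\<close> derives.\<close>

locale haar_orthogonal_measure = prob_space \<mu> for \<mu> :: "(real^'n^'n) measure" +
  assumes sets_\<mu>: "sets \<mu> = sets (restrict_space borel {U. orthogonal_matrix U})"
    and distr_left: "orthogonal_matrix Q \<Longrightarrow> distr \<mu> \<mu> (\<lambda>U. Q ** U) = \<mu>"

lemma haar_orthogonal_iff: "haar_orthogonal \<mu> \<longleftrightarrow> haar_orthogonal_measure \<mu>"
  by (auto simp: haar_orthogonal_def haar_orthogonal_measure_def haar_orthogonal_measure_axioms_def)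

context haar_orthogonal_measure
begin

lemma space_\<mu>: "space \<mu> = {U. orthogonal_matrix U}"
  using sets_eq_imp_space_eq[OF sets_\<mu>] by (simp add: space_restrict_space)

lemma measurable_borel: "f \<in> borel \<rightarrow>\<^sub>M N \<Longrightarrow> f \<in> \<mu> \<rightarrow>\<^sub>M N"
  by (subst measurable_cong_sets[OF sets_\<mu> refl]) (rule measurable_restrict_space1)

lemma measurable_continuous: "continuous_on UNIV f \<Longrightarrow> f \<in> borel_measurable \<mu>"
  by (intro measurable_borel borel_measurable_continuous_onI)

lemma measurable_into:
  "f \<in> N \<rightarrow>\<^sub>M borel \<Longrightarrow> (\<And>x. x \<in> space N \<Longrightarrow> orthogonal_matrix (f x)) \<Longrightarrow> f \<in> N \<rightarrow>\<^sub>M \<mu>"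
  by (subst measurable_cong_sets[OF refl sets_\<mu>]) (auto intro: measurable_restrict_space2)

lemma measurable_left [measurable]:
  "orthogonal_matrix Q \<Longrightarrow> (\<lambda>U. Q ** U) \<in> \<mu> \<rightarrow>\<^sub>M \<mu>"
  by (intro measurable_into measurable_continuous continuous_intros)
    (simp add: space_\<mu> orthogonal_matrix_mul)

lemma measurable_transpose [measurable]: "transpose \<in> \<mu> \<rightarrow>\<^sub>M \<mu>"
  by (intro measurable_into measurable_continuous continuous_intros) (simp add: space_\<mu>)

lemma measurable_transpose_mult [measurable]:
  "(\<lambda>(V, U). transpose V ** U) \<in> \<mu> \<Otimes>\<^sub>M \<mu> \<rightarrow>\<^sub>M \<mu>"
proof (rule measurable_into)
  have [measurable]: "(\<lambda>U. U) \<in> borel_measurable \<mu>"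
    by (intro measurable_continuous continuous_intros)
  have "(\<lambda>x. transpose (fst x) ** snd x) \<in> borel_measurable (\<mu> \<Otimes>\<^sub>M \<mu>)"
    by (rule borel_measurable_continuous_Pair[where H = "\<lambda>V U. transpose V ** U"])
      (measurable, intro continuous_intros)
  then show "(\<lambda>(V, U). transpose V ** U) \<in> borel_measurable (\<mu> \<Otimes>\<^sub>M \<mu>)"
    by (simp add: case_prod_beta)
qed (auto simp: space_pair_measure space_\<mu> orthogonal_matrix_mul)

lemma nn_integral_left:
  assumes "orthogonal_matrix Q" and [measurable]: "f \<in> borel_measurable \<mu>"
  shows "(\<integral>\<^sup>+U. f (Q ** U) \<partial>\<mu>) = (\<integral>\<^sup>+U. f U \<partial>\<mu>)"
proof -
  have "(\<integral>\<^sup>+U. f U \<partial>\<mu>) = (\<integral>\<^sup>+U. f U \<partial>distr \<mu> \<mu> (\<lambda>U. Q ** U))"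
    by (simp add: distr_left assms(1))
  also have "\<dots> = (\<integral>\<^sup>+U. f (Q ** U) \<partial>\<mu>)"
    by (rule nn_integral_distr) (use assms in measurable)
  finally show ?thesis by simp
qed

text \<open>
  Integrating \<open>f (V\<^sup>T U)\<close> first over \<open>U\<close> gives the integral of \<open>f\<close>; since \<open>V\<^sup>T U = (U\<^sup>T V)\<^sup>T\<close>,
  integrating first over \<open>V\<close> gives that of \<open>f\<close> composed with transposition.
\<close>

lemma nn_integral_transpose:
  assumes [measurable]: "f \<in> borel_measurable \<mu>"
  shows "(\<integral>\<^sup>+U. f (transpose U) \<partial>\<mu>) = (\<integral>\<^sup>+U. f U \<partial>\<mu>)"
proof -
  interpret P: pair_prob_space \<mu> \<mu> ..
  have m: "(\<lambda>(V, U). f (transpose V ** U)) \<in> borel_measurable (\<mu> \<Otimes>\<^sub>M \<mu>)"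
    using measurable_compose[OF measurable_transpose_mult assms] by (simp add: case_prod_beta)
  have "(\<integral>\<^sup>+U. f U \<partial>\<mu>) = (\<integral>\<^sup>+V. \<integral>\<^sup>+U. f U \<partial>\<mu> \<partial>\<mu>)"
    by (simp add: emeasure_space_1)
  also have "\<dots> = (\<integral>\<^sup>+V. \<integral>\<^sup>+U. f (transpose V ** U) \<partial>\<mu> \<partial>\<mu>)"
    by (intro nn_integral_cong nn_integral_left[symmetric] assms) (simp add: space_\<mu>)
  also have "\<dots> = (\<integral>\<^sup>+U. \<integral>\<^sup>+V. f (transpose V ** U) \<partial>\<mu> \<partial>\<mu>)"
    using P.Fubini[OF m] by simp
  also have "\<dots> = (\<integral>\<^sup>+U. \<integral>\<^sup>+V. f (transpose (transpose U ** V)) \<partial>\<mu> \<partial>\<mu>)"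
    by (simp add: matrix_transpose_mul)
  also have "\<dots> = (\<integral>\<^sup>+U. \<integral>\<^sup>+V. f (transpose V) \<partial>\<mu> \<partial>\<mu>)"
    by (intro nn_integral_cong nn_integral_left[where f = "\<lambda>W. f (transpose W)"])
      (auto simp: space_\<mu>)
  also have "\<dots> = (\<integral>\<^sup>+V. f (transpose V) \<partial>\<mu>)"
    by (simp add: emeasure_space_1)
  finally show ?thesis by simp
qed

lemma distr_transpose: "distr \<mu> \<mu> transpose = \<mu>"
proof (rule measure_eqI)
  fix A assume "A \<in> sets (distr \<mu> \<mu> transpose)"
  then have [measurable]: "A \<in> sets \<mu>" by simp
  have "emeasure (distr \<mu> \<mu> transpose) A = (\<integral>\<^sup>+U. indicator A U \<partial>distr \<mu> \<mu> transpose)"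
    by simp
  also have "\<dots> = (\<integral>\<^sup>+U. indicator A (transpose U) \<partial>\<mu>)"
    by (rule nn_integral_distr) measurable
  also have "\<dots> = emeasure \<mu> A"
    by (subst nn_integral_transpose) auto
  finally show "emeasure (distr \<mu> \<mu> transpose) A = emeasure \<mu> A" .
qed simp

text \<open>Right multiplication by \<open>Q\<close> is transposition, then left multiplication by
  the transpose of \<open>Q\<close>, then transposition again; each of the three preserves
  \<open>\<mu>\<close>.\<close>

lemma distr_right:
  assumes Q: "orthogonal_matrix Q"
  shows "distr \<mu> \<mu> (\<lambda>U. U ** Q) = \<mu>"
proof -
  have "distr \<mu> \<mu> (\<lambda>U. U ** Q) = distr \<mu> \<mu> (transpose \<circ> ((\<lambda>U. transpose Q ** U) \<circ> transpose))"
    by (simp add: comp_def matrix_transpose_mul)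
  also have "\<dots> = distr (distr (distr \<mu> \<mu> transpose) \<mu> (\<lambda>U. transpose Q ** U)) \<mu> transpose"
    using Q by (simp add: distr_distr measurable_comp[OF measurable_transpose] comp_assoc)
  also have "\<dots> = \<mu>"
    using Q by (simp add: distr_transpose distr_left)
  finally show ?thesis .
qed

lemma integral_right:
  fixes f :: "real^'n^'n \<Rightarrow> real"
  assumes Q: "orthogonal_matrix Q" and f: "continuous_on UNIV f"
  shows "(\<integral>U. f (U ** Q) \<partial>\<mu>) = (\<integral>U. f U \<partial>\<mu>)"
proof -
  have m: "(\<lambda>U. U ** Q) \<in> \<mu> \<rightarrow>\<^sub>M \<mu>"
    by (intro measurable_into measurable_continuous continuous_intros)
      (simp add: space_\<mu> orthogonal_matrix_mul Q)
  have "(\<integral>U. f U \<partial>\<mu>) = (\<integral>U. f U \<partial>distr \<mu> \<mu> (\<lambda>U. U ** Q))"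
    by (simp add: distr_right Q)
  also have "\<dots> = (\<integral>U. f (U ** Q) \<partial>\<mu>)"
    by (rule integral_distr[OF m]) (rule measurable_continuous[OF f])
  finally show ?thesis by simp
qed

end

section \<open>Plane reflections and row projections\<close>

text \<open>For \<open>i \<noteq> j\<close> this acts on coordinates \<open>i\<close>,
  \<open>j\<close> by the matrix with rows (c, s) and (s, -c), and as the identity elsewhere. Three
  choices of (c, s) are used below: (1, 0) negates coordinate \<open>j\<close>, (0, 1) swaps the two
  coordinates, and both entries equal to 1 / sqrt 2 mix them.\<close>

definition plane_reflection :: "'n \<Rightarrow> 'n \<Rightarrow> real \<Rightarrow> real \<Rightarrow> real^'n^'n" where
  "plane_reflection i j c s = (\<chi> b l.
     if l = i then (if b = i then c else if b = j then s else 0)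
     else if l = j then (if b = i then s else if b = j then - c else 0)
     else if b = l then 1 else 0)"

lemma mult_plane_reflection:
  fixes U :: "real^'n^'n"
  assumes "i \<noteq> j"
  shows "(U ** plane_reflection i j c s) $ a $ l =
    (if l = i then c * U $ a $ i + s * U $ a $ j
     else if l = j then s * U $ a $ i - c * U $ a $ j else U $ a $ l)"
proof -
  have "(U ** plane_reflection i j c s) $ a $ l = (\<Sum>b\<in>UNIV.
      if l = i then (if b = i then c * U $ a $ b else 0) + (if b = j then s * U $ a $ b else 0)
      else if l = j then (if b = i then s * U $ a $ b else 0) + (if b = j then - c * U $ a $ b else 0)
      else if b = l then U $ a $ b else 0)"
    unfolding matrix_matrix_mult_def plane_reflection_def using assms
    by (auto intro!: sum.cong)
  also have "\<dots> = (if l = i then c * U $ a $ i + s * U $ a $ j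
     else if l = j then s * U $ a $ i - c * U $ a $ j else U $ a $ l)"
    by (cases "l = i"; cases "l = j") (simp_all add: sum.distrib)
  finally show ?thesis .
qed

lemma orthogonal_plane_reflection:
  assumes "i \<noteq> j" "c\<^sup>2 + s\<^sup>2 = 1"
  shows "orthogonal_matrix (plane_reflection i j c s)"
proof -
  have "transpose (plane_reflection i j c s) = plane_reflection i j c s"
    using assms(1) by (auto simp: vec_eq_iff transpose_def plane_reflection_def)
  moreover have "plane_reflection i j c s ** plane_reflection i j c s = mat 1"
    using assms(1,2) unfolding vec_eq_iff mult_plane_reflection[OF assms(1)]
    by (auto simp: plane_reflection_def mat_def power2_eq_square algebra_simps)
  ultimately show ?thesis by (simp add: orthogonal_matrix)
qed

lemma orthogonal_matrix_rows:
  fixes U :: "real^'n^'n"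
  assumes "orthogonal_matrix U"
  shows "row a U \<bullet> row b U = (if a = b then 1 else 0)"
  using assms by (auto simp: orthogonal_matrix_orthonormal_rows orthogonal_def norm_eq_1)

text \<open>For orthogonal \<open>U\<close> and \<open>r\<close> injective on \<open>{..<k}\<close>,
  the orthogonal projection onto the span of the chosen rows.\<close>

definition row_proj :: "(nat \<Rightarrow> 'n) \<Rightarrow> nat \<Rightarrow> real^'n^'n \<Rightarrow> real^'n^'n" where
  "row_proj r k U = (\<Sum>a<k. outer (row (r a) U) (row (r a) U))"

lemma row_proj_nth: "row_proj r k U $ l $ m = (\<Sum>a<k. U $ r a $ l * U $ r a $ m)"
  by (simp add: row_proj_def outer_def row_def)

lemma row_proj_sym: "row_proj r k U $ l $ m = row_proj r k U $ m $ l"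
  by (simp add: row_proj_nth mult.commute)

text \<open>Replacing \<open>U\<close> by \<open>U ** Q\<close> turns the row projection P into
  \<open>transpose Q ** P ** Q\<close>. This lemma and the next two read off entries for the three
  reflections.\<close>

lemma row_proj_flip:
  assumes "i \<noteq> j"
  shows "row_proj r k (U ** plane_reflection i j 1 0) $ l $ m
     = (if l = j then -1 else 1) * (if m = j then -1 else 1) * row_proj r k U $ l $ m"
  unfolding row_proj_nth mult_plane_reflection[OF assms] sum_distrib_left
  using assms by (intro sum.cong refl) auto

lemma row_proj_swap:
  assumes "i \<noteq> j"
  shows "row_proj r k (U ** plane_reflection i j 0 1) $ l $ m
     = row_proj r k U $ (Transposition.transpose i j l) $ (Transposition.transpose i j m)"
  unfolding row_proj_nth mult_plane_reflection[OF assms]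
  by (auto simp: Transposition.transpose_def intro!: sum.cong)

text \<open>The new columns \<open>i\<close> and \<open>j\<close> are the sum and the difference of
  the old ones over sqrt 2, so the mixed terms of their product cancel.\<close>

lemma row_proj_diagonal_reflection:
  assumes "i \<noteq> j"
  shows "row_proj r k (U ** plane_reflection i j (1 / sqrt 2) (1 / sqrt 2)) $ i $ j
     = (row_proj r k U $ i $ i - row_proj r k U $ j $ j) / 2"
proof -
  have "(x / sqrt 2 + y / sqrt 2) * (x / sqrt 2 - y / sqrt 2) = (x * x - y * y) / 2" for x y :: real
    by (simp add: algebra_simps diff_divide_distrib)
  then show ?thesis
    unfolding row_proj_nth mult_plane_reflection[OF assms] sum_subtractf[symmetric] sum_divide_distrib
    using assms by (intro sum.cong refl) simp
qed

lemma continuous_row_proj [continuous_intros]: "continuous_on S (\<lambda>U. row_proj r k U $ i $ j)"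
  unfolding row_proj_nth by (intro continuous_intros)

text \<open>A crude bound from the unit length of the rows; it makes the entries and their products
  integrable.\<close>

lemma abs_row_proj_le:
  assumes "orthogonal_matrix U"
  shows "\<bar>row_proj r k U $ i $ j\<bar> \<le> real k"
proof -
  have 1: "\<bar>U $ a $ l\<bar> \<le> 1" for a l
    using component_le_norm_cart[of "row a U" l] assms
    by (simp add: orthogonal_matrix_orthonormal_rows row_def)
  have "\<bar>row_proj r k U $ i $ j\<bar> \<le> (\<Sum>a<k. \<bar>U $ r a $ i * U $ r a $ j\<bar>)"
    unfolding row_proj_nth by (rule sum_abs)
  also have "\<dots> \<le> (\<Sum>a<k. 1)"
    by (intro sum_mono) (simp add: abs_mult mult_le_one 1)
  finally show ?thesis by simp
qed

lemma trace_row_proj: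
  assumes "orthogonal_matrix U"
  shows "trace (row_proj r k U) = real k"
  unfolding row_proj_def trace_sum trace_outer orthogonal_matrix_rows[OF assms] by simp

lemma row_proj_inner_self:
  assumes "orthogonal_matrix U" "inj_on r {..<k}"
  shows "row_proj r k U \<bullet> row_proj r k U = real k"
  unfolding row_proj_def using assms
  by (subst inner_sum_outer_orthonormal) (auto simp: orthogonal_matrix_rows inj_on_def)


section \<open>First and second moments of a random row projection\<close>

text \<open>Expand the squared norm of \<open>A - transpose A\<close>. This lets the variance bound
  cover matrices that are not symmetric.\<close>

lemma inner_transpose_le: "A \<bullet> transpose A \<le> A \<bullet> (A :: real^'n^'n)"
proof -
  have "transpose A \<bullet> transpose A = A \<bullet> A"
    unfolding inner_vec_def by (simp add: transpose_def) (rule sum.swap)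
  moreover have "0 \<le> (A - transpose A) \<bullet> (A - transpose A)" by simp
  ultimately show ?thesis by (simp add: inner_diff inner_commute)
qed

lemma inner_eq_sum: "A \<bullet> B = (\<Sum>i\<in>UNIV. \<Sum>j\<in>UNIV. A $ i $ j * B $ i $ (j::'n))" for A B :: "real^'n^'m"
  by (simp add: inner_vec_def)

context haar_orthogonal_measure
begin

lemma integrable_row_proj: "integrable \<mu> (\<lambda>U. row_proj r k U $ i $ j)"
  by (rule integrable_const_bound[where B = "real k"])
    (auto intro!: measurable_continuous continuous_intros abs_row_proj_le simp: space_\<mu>)

lemma integrable_row_proj_mult: "integrable \<mu> (\<lambda>U. row_proj r k U $ i $ j * row_proj r k U $ l $ m)"
  by (rule integrable_const_bound[where B = "real k * real k"])
    (auto intro!: measurable_continuous continuous_intros mult_mono abs_row_proj_le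
      simp: space_\<mu> abs_mult)

lemma integrable_row_proj_inner: "integrable \<mu> (\<lambda>U. row_proj r k U \<bullet> A)"
  unfolding inner_eq_sum by (intro Bochner_Integration.integrable_sum integrable_mult_left integrable_row_proj)

lemma row_proj_inner_sq:
  "(row_proj r k U \<bullet> A)\<^sup>2 = (\<Sum>i\<in>UNIV. \<Sum>j\<in>UNIV. \<Sum>l\<in>UNIV. \<Sum>m\<in>UNIV.
     row_proj r k U $ i $ j * row_proj r k U $ l $ m * (A $ i $ j * A $ l $ m))"
  unfolding inner_eq_sum power2_eq_square sum_distrib_left sum_distrib_right
  by (intro sum.cong refl) (simp add: mult_ac)

lemma integrable_row_proj_inner_sq: "integrable \<mu> (\<lambda>U. (row_proj r k U \<bullet> A)\<^sup>2)"
  unfolding row_proj_inner_sq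
  by (intro Bochner_Integration.integrable_sum integrable_mult_left integrable_row_proj_mult)

text \<open>Negating coordinate \<open>j\<close> preserves the measure and changes the sign of the
  integrand.\<close>

lemma first_moment_off_diagonal:
  assumes "i \<noteq> j"
  shows "(\<integral>U. row_proj r k U $ i $ j \<partial>\<mu>) = 0"
proof -
  have "(\<integral>U. row_proj r k U $ i $ j \<partial>\<mu>)
      = (\<integral>U. row_proj r k (U ** plane_reflection i j 1 0) $ i $ j \<partial>\<mu>)"
    using assms by (intro integral_right[symmetric] orthogonal_plane_reflection continuous_intros) auto
  also have "\<dots> = - (\<integral>U. row_proj r k U $ i $ j \<partial>\<mu>)"
    using assms by (simp add: row_proj_flip)
  finally show ?thesis by simp
qed

text \<open>Swapping coordinates makes all diagonal expectations equal, and they add up to the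
  constant trace \<open>k\<close>.\<close>

lemma first_moment_diagonal:
  "(\<integral>U. row_proj r k U $ i $ i \<partial>\<mu>) = real k / real CARD('n)"
proof -
  have eq: "(\<integral>U. row_proj r k U $ j $ j \<partial>\<mu>) = (\<integral>U. row_proj r k U $ i $ i \<partial>\<mu>)" for j
  proof (cases "i = j")
    case False
    then have "(\<integral>U. row_proj r k U $ j $ j \<partial>\<mu>)
      = (\<integral>U. row_proj r k (U ** plane_reflection i j 0 1) $ j $ j \<partial>\<mu>)"
      by (intro integral_right[symmetric] orthogonal_plane_reflection continuous_intros) auto
    also have "\<dots> = (\<integral>U. row_proj r k U $ i $ i \<partial>\<mu>)"
      using False by (simp add: row_proj_swap)
    finally show ?thesis .
  qed simp
  have "real k = (\<integral>U. real k \<partial>\<mu>)" by (simp add: prob_space)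
  also have "\<dots> = (\<integral>U. trace (row_proj r k U) \<partial>\<mu>)"
    by (intro Bochner_Integration.integral_cong refl) (simp add: space_\<mu> trace_row_proj)
  also have "\<dots> = (\<Sum>j\<in>UNIV. \<integral>U. row_proj r k U $ j $ j \<partial>\<mu>)"
    unfolding trace_def by (intro Bochner_Integration.integral_sum integrable_row_proj)
  also have "\<dots> = real CARD('n) * (\<integral>U. row_proj r k U $ i $ i \<partial>\<mu>)"
    by (subst sum.cong[OF refl eq]) simp_all
  finally show ?thesis by (simp add: field_simps)
qed

lemma expectation_row_proj_inner:
  "(\<integral>U. row_proj r k U \<bullet> A \<partial>\<mu>) = real k / real CARD('n) * trace A"
proof -
  have "(\<integral>U. row_proj r k U \<bullet> A \<partial>\<mu>)
      = (\<Sum>i\<in>UNIV. \<Sum>j\<in>UNIV. (\<integral>U. row_proj r k U $ i $ j \<partial>\<mu>) * A $ i $ j)"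
    unfolding inner_eq_sum
    by (simp add: Bochner_Integration.integral_sum Bochner_Integration.integrable_sum integrable_row_proj)
  also have "\<dots> = (\<Sum>i\<in>UNIV. \<Sum>j\<in>UNIV. if i = j then real k / real CARD('n) * A $ i $ j else 0)"
    by (intro sum.cong refl) (simp add: first_moment_off_diagonal first_moment_diagonal)
  finally show ?thesis by (simp add: trace_def sum_distrib_left)
qed

definition moment :: "(nat \<Rightarrow> 'n) \<Rightarrow> nat \<Rightarrow> 'n \<Rightarrow> 'n \<Rightarrow> 'n \<Rightarrow> 'n \<Rightarrow> real" where
  "moment r k i j l m = (\<integral>U. row_proj r k U $ i $ j * row_proj r k U $ l $ m \<partial>\<mu>)"

lemma moment_reflect:
  assumes "p \<noteq> q" "c\<^sup>2 + s\<^sup>2 = 1"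
  shows "moment r k i j l m = (\<integral>U. row_proj r k (U ** plane_reflection p q c s) $ i $ j
     * row_proj r k (U ** plane_reflection p q c s) $ l $ m \<partial>\<mu>)"
  unfolding moment_def using assms
  by (intro integral_right[symmetric, where f = "\<lambda>U. row_proj r k U $ i $ j * row_proj r k U $ l $ m"]
    orthogonal_plane_reflection continuous_intros)

lemma moment_commute: "moment r k i j l m = moment r k l m i j"
  by (simp add: moment_def mult.commute)

lemma moment_sym1: "moment r k i j l m = moment r k j i l m"
  by (simp add: moment_def row_proj_sym[of r k _ i j])

lemma moment_swap:
  assumes "p \<noteq> q"
  shows "moment r k i j l m = moment r k (Transposition.transpose p q i) (Transposition.transpose p q j)
    (Transposition.transpose p q l) (Transposition.transpose p q m)"
  by (subst moment_reflect[OF assms, of 0 1]) (simp_all add: row_proj_swap[OF assms] moment_def)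

text \<open>The sign condition says that \<open>q\<close> occurs an odd number of times among the
  four indices, so negating coordinate \<open>q\<close> turns the moment into its own negative;
  \<open>p\<close> completes the plane of the reflection.\<close>

lemma moment_flip:
  assumes "p \<noteq> q" and odd: "(if i = q then -1 else 1) * (if j = q then -1 else 1)
    * (if l = q then -1 else 1) * (if m = q then -1 else (1::real)) = -1"
  shows "moment r k i j l m = 0"
proof -
  let ?p = "row_proj r k"
  have "moment r k i j l m = (\<integral>U. ((if i = q then -1 else 1) * (if j = q then -1 else 1) *
      (if l = q then -1 else 1) * (if m = q then -1 else 1)) * (?p U $ i $ j * ?p U $ l $ m) \<partial>\<mu>)"
    by (subst moment_reflect[OF assms(1), of 1 0]) (simp_all add: row_proj_flip[OF assms(1)] mult_ac)
  also have "\<dots> = - moment r k i j l m"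
    unfolding odd by (simp add: moment_def)
  finally show ?thesis by simp
qed

lemma moment_eq_0:
  assumes "i \<noteq> j" "\<not> (l = i \<and> m = j)" "\<not> (l = j \<and> m = i)"
  shows "moment r k i j l m = 0"
\<comment> \<open>Choose an index of odd multiplicity. In the first case this is \<open>j\<close>.
  Otherwise exactly one of \<open>l\<close>, \<open>m\<close> is \<open>j\<close> and the other is
  not \<open>i\<close>, so \<open>i\<close> occurs once.\<close>
proof (cases "l = m \<or> (l \<noteq> j \<and> m \<noteq> j)")
  case True
  then show ?thesis using assms by (intro moment_flip[of i j]) auto
next
  case False
  then show ?thesis using assms by (intro moment_flip[of j i]) auto
qed

lemma moment_diagonal: "moment r k i i i i = moment r k j j j j"
  by (cases "i = j") (use moment_swap[of i j r k i i i i] in auto)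

lemma moment_mixed_step: "i \<noteq> j \<Longrightarrow> i' \<noteq> j \<Longrightarrow> moment r k i i j j = moment r k i' i' j j"
  by (cases "i = i'") (use moment_swap[of i i' r k i i j j] in \<open>auto simp: Transposition.transpose_def\<close>)

text \<open>Swaps replace the first index pair while the second stays distinct from it; exchanging
  the two factors gives access to the second. If \<open>j = a\<close>, the first pair cannot become
  \<open>a\<close>, so it becomes \<open>b\<close> before the exchange.\<close>

lemma moment_mixed:
  assumes "i \<noteq> j" "a \<noteq> b"
  shows "moment r k i i j j = moment r k a a b b"
proof (cases "j = a")
  case True
  then show ?thesis
    using assms moment_mixed_step[of i a b r k] moment_commute[of r k b b a a] by auto
next
  case False
  then have "moment r k i i j j = moment r k a a j j"
    using assms by (intro moment_mixed_step) auto
  also have "\<dots> = moment r k b b a a"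
    using False assms by (subst moment_commute) (intro moment_mixed_step, auto)
  finally show ?thesis by (simp add: moment_commute[of r k b b a a])
qed

text \<open>The reflection with \<open>c = s = 1/\<surd>2\<close> ties the off-diagonal second moment to the diagonal ones.\<close>

lemma moment_off_diagonal:
  assumes "i \<noteq> j"
  shows "moment r k i j i j = (moment r k i i i i - moment r k i i j j) / 2"
proof -
  let ?p = "\<lambda>U. row_proj r k U"
  have "moment r k i j i j = (\<integral>U. (?p U $ i $ i - ?p U $ j $ j) / 2 * ((?p U $ i $ i - ?p U $ j $ j) / 2) \<partial>\<mu>)"
    by (subst moment_reflect[OF assms, of "1 / sqrt 2" "1 / sqrt 2"])
      (simp_all only: row_proj_diagonal_reflection[OF assms], simp add: power_divide)
  also have "\<dots> = (\<integral>U. (?p U $ i $ i * ?p U $ i $ i - 2 * (?p U $ i $ i * ?p U $ j $ j)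
      + ?p U $ j $ j * ?p U $ j $ j) / 4 \<partial>\<mu>)"
    by (simp add: algebra_simps)
  also have "\<dots> = (moment r k i i i i - 2 * moment r k i i j j + moment r k j j j j) / 4"
    by (simp add: moment_def integrable_row_proj_mult)
  finally show ?thesis using moment_diagonal[of r k i j] by simp
qed

text \<open>Sign changes kill the moments with an index of odd multiplicity, swaps leave the three
  types iiii, iijj and ijij, and the diagonal reflection relates these, so two constants remain. For
  n = 1 the split between them is free; \<open>\<gamma>\<close> = 0 makes the variance constant
  vanish there.\<close>

lemma moment_tensor:
  obtains \<beta> \<gamma> where "0 \<le> \<gamma>" "CARD('n) = 1 \<Longrightarrow> \<gamma> = 0"
    "\<And>i j l m. moment r k i j l m = (if i = j \<and> l = m then \<beta> else 0)
       + \<gamma> * ((if l = i \<and> m = j then 1 else 0) + (if l = j \<and> m = i then 1 else 0))"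
proof (cases "CARD('n) = 1")
  case True
  then obtain z :: 'n where "(UNIV :: 'n set) = {z}" by (auto simp: card_1_singleton_iff)
  then have z: "x = z" for x :: 'n by auto
  have "moment r k i j l m = moment r k z z z z" for i j l m
    using z[of i] z[of j] z[of l] z[of m] by simp
  moreover have "i = j" for i j :: 'n using z[of i] z[of j] by simp
  \<comment> \<open>\<open>of\<close> fills \<open>\<gamma>\<close> first, as it occurs first in the
    rule; \<open>\<beta>\<close> carries the single moment.\<close>
  ultimately show ?thesis by (intro that[of 0 "moment r k z z z z"]) auto
next
  case False
  have "\<exists>a b :: 'n. a \<noteq> b"
  proof (rule ccontr)
    assume "\<nexists>a b :: 'n. a \<noteq> b"
    then have "(UNIV :: 'n set) = {undefined}" by auto
    then show False using False by (metis card_1_singleton_iff One_nat_def)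
  qed
  then obtain a b :: 'n where ab: "a \<noteq> b" by auto
  let ?\<beta> = "moment r k a a b b" and ?\<gamma> = "moment r k a b a b"
  have ij: "moment r k i j i j = ?\<gamma>" if "i \<noteq> j" for i j
    using moment_mixed[OF that ab, of r k] moment_diagonal[of r k i a]
    by (simp add: moment_off_diagonal that ab)
  have ii: "moment r k i i i i = ?\<beta> + 2 * ?\<gamma>" for i
    using moment_diagonal[of r k i a] moment_off_diagonal[OF ab, of r k] by simp
  show ?thesis
  proof (rule that[of ?\<gamma> ?\<beta>])
    show "0 \<le> ?\<gamma>" by (simp add: moment_def)
    fix i j l m :: 'n
    have ji: "moment r k i j j i = ?\<gamma>" if "i \<noteq> j"
      using moment_sym1[of r k i j j i] ij[of j i] that by simp
    have il: "moment r k i i l m = 0" if "l \<noteq> m"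
      using moment_eq_0[of l m i i r k] that moment_commute[of r k i i l m] by auto
    show "moment r k i j l m = (if i = j \<and> l = m then ?\<beta> else 0)
       + ?\<gamma> * ((if l = i \<and> m = j then 1 else 0) + (if l = j \<and> m = i then 1 else 0))"
    proof (cases "i = j")
      case True
      then show ?thesis
        using ii[of i] il moment_mixed[OF _ ab, of i l r k] by (cases "l = m"; cases "i = l") auto
    next
      case False
      then show ?thesis using ij ji moment_eq_0[of i j l m r k] by auto
    qed
  qed (use False in simp)
qed

text \<open>The quadratic form is the moment tensor contracted with \<open>A\<close> twice. The
  relation between \<open>\<beta>\<close> and \<open>\<gamma>\<close> expresses that the squared
  norm of the projection is constantly \<open>k\<close>.\<close>

lemma second_moment:
  assumes r: "inj_on r {..<k}"
  obtains \<beta> \<gamma> where "0 \<le> \<gamma>" "CARD('n) = 1 \<Longrightarrow> \<gamma> = 0"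
    "real CARD('n) * \<beta> + real CARD('n) * (real CARD('n) + 1) * \<gamma> = real k"
    "\<And>A. (\<integral>U. (row_proj r k U \<bullet> A)\<^sup>2 \<partial>\<mu>) = \<beta> * (trace A)\<^sup>2 + \<gamma> * (A \<bullet> A + A \<bullet> transpose A)"
proof -
  obtain \<beta> \<gamma> where bg: "0 \<le> \<gamma>" "CARD('n) = 1 \<Longrightarrow> \<gamma> = 0"
    and mom: "\<And>i j l m. moment r k i j l m = (if i = j \<and> l = m then \<beta> else 0)
       + \<gamma> * ((if l = i \<and> m = j then 1 else 0) + (if l = j \<and> m = i then 1 else 0))"
    by (rule moment_tensor[of r k], rule that) blast+
  have "real k = (\<integral>U. real k \<partial>\<mu>)" by (simp add: prob_space)
  also have "\<dots> = (\<integral>U. row_proj r k U \<bullet> row_proj r k U \<partial>\<mu>)"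
    by (intro Bochner_Integration.integral_cong refl) (simp add: space_\<mu> row_proj_inner_self r)
  also have "\<dots> = (\<Sum>i\<in>UNIV. \<Sum>j\<in>UNIV. moment r k i j i j)"
    unfolding inner_eq_sum moment_def
    by (simp add: Bochner_Integration.integral_sum Bochner_Integration.integrable_sum integrable_row_proj_mult)
  also have "\<dots> = (\<Sum>i\<in>UNIV. \<Sum>j\<in>(UNIV :: 'n set). \<gamma> + (if i = j then \<beta> + \<gamma> else 0))"
    unfolding mom by (intro sum.cong refl) auto
  also have "\<dots> = real CARD('n) * \<beta> + real CARD('n) * (real CARD('n) + 1) * \<gamma>"
    by (simp add: sum.distrib) (simp add: algebra_simps)
  finally have k: "real CARD('n) * \<beta> + real CARD('n) * (real CARD('n) + 1) * \<gamma> = real k" by simp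
  have "(\<integral>U. (row_proj r k U \<bullet> A)\<^sup>2 \<partial>\<mu>) = \<beta> * (trace A)\<^sup>2 + \<gamma> * (A \<bullet> A + A \<bullet> transpose A)" for A
  proof -
    have "(\<integral>U. (row_proj r k U \<bullet> A)\<^sup>2 \<partial>\<mu>) = (\<Sum>i\<in>UNIV. \<Sum>j\<in>UNIV. \<Sum>l\<in>UNIV. \<Sum>m\<in>UNIV.
        moment r k i j l m * (A $ i $ j * A $ l $ m))"
      unfolding row_proj_inner_sq moment_def
      by (simp add: Bochner_Integration.integral_sum Bochner_Integration.integrable_sum integrable_row_proj_mult)
    also have "\<dots> = (\<Sum>i\<in>UNIV. \<Sum>j\<in>UNIV. \<Sum>l\<in>UNIV.
        (if i = j then \<beta> * (A $ i $ i * A $ l $ l) else 0)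
        + (if l = i then \<gamma> * (A $ i $ j * A $ i $ j) else 0)
        + (if l = j then \<gamma> * (A $ i $ j * A $ j $ i) else 0))"
    proof (intro sum.cong refl)
      fix i j l :: 'n
      \<comment> \<open>Each delta pattern fixes \<open>m\<close>, so the innermost sum collapses to
        three terms.\<close>
      have "(\<Sum>m\<in>UNIV. moment r k i j l m * (A $ i $ j * A $ l $ m)) = (\<Sum>m\<in>UNIV.
          (if m = l then (if i = j then \<beta> * (A $ i $ i * A $ l $ l) else 0) else 0)
          + (if m = j then (if l = i then \<gamma> * (A $ i $ j * A $ i $ j) else 0) else 0)
          + (if m = i then (if l = j then \<gamma> * (A $ i $ j * A $ j $ i) else 0) else 0))"
        unfolding mom by (intro sum.cong refl) (auto simp: algebra_simps)
      then show "(\<Sum>m\<in>UNIV. moment r k i j l m * (A $ i $ j * A $ l $ m)) =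
          (if i = j then \<beta> * (A $ i $ i * A $ l $ l) else 0)
        + (if l = i then \<gamma> * (A $ i $ j * A $ i $ j) else 0)
        + (if l = j then \<gamma> * (A $ i $ j * A $ j $ i) else 0)"
        by (simp add: sum.distrib)
    qed
    also have "\<dots> = (\<Sum>i\<in>UNIV. \<Sum>j\<in>UNIV.
        (if j = i then \<beta> * (A $ i $ i * trace A) else 0)
        + \<gamma> * (A $ i $ j * A $ i $ j) + \<gamma> * (A $ i $ j * A $ j $ i))"
      by (intro sum.cong refl) (auto simp: sum.distrib trace_def sum_distrib_left)
    also have "\<dots> = \<beta> * (\<Sum>i\<in>UNIV. A $ i $ i * trace A) + \<gamma> * (A \<bullet> A + A \<bullet> transpose A)"
      by (simp add: sum.distrib inner_eq_sum transpose_def distrib_left flip: sum_distrib_left)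
    also have "(\<Sum>i\<in>UNIV. A $ i $ i * trace A) = (trace A)\<^sup>2"
      by (simp add: trace_def power2_eq_square sum_distrib_right)
    finally show ?thesis .
  qed
  then show ?thesis using that bg k by blast
qed

lemma row_proj_variance:
  assumes r: "inj_on r {..<k}" and k: "1 \<le> k"
  obtains c where "0 \<le> c" "CARD('n) = 1 \<Longrightarrow> c = 0"
    "c * (real CARD('n) * (real CARD('n) + 1) / 2 - 1) = (real CARD('n))\<^sup>2 / real k - real CARD('n)"
    "\<And>A. (\<integral>U. (real CARD('n) / real k * (row_proj r k U \<bullet> A) - trace A)\<^sup>2 \<partial>\<mu>) \<le> c * (norm A)\<^sup>2"
proof -
  let ?n = "real CARD('n)"
  obtain \<beta> \<gamma> where g: "0 \<le> \<gamma>" "CARD('n) = 1 \<Longrightarrow> \<gamma> = 0"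
    and e1: "?n * \<beta> + ?n * (?n + 1) * \<gamma> = real k"
    and sq: "\<And>A. (\<integral>U. (row_proj r k U \<bullet> A)\<^sup>2 \<partial>\<mu>) = \<beta> * (trace A)\<^sup>2 + \<gamma> * (A \<bullet> A + A \<bullet> transpose A)"
    by (rule second_moment[OF r], rule that) blast+
  have n: "?n > 0" and kp: "real k > 0" using k by auto
  \<comment> \<open>Testing against the identity, where the inner product is the constant trace
    \<open>k\<close>, gives a second linear equation for \<open>\<beta>\<close> and
    \<open>\<gamma>\<close>.\<close>
  have "(real k)\<^sup>2 = (\<integral>U. (real k)\<^sup>2 \<partial>\<mu>)" by (simp add: prob_space)
  also have "\<dots> = (\<integral>U. (row_proj r k U \<bullet> mat 1)\<^sup>2 \<partial>\<mu>)"
    by (intro Bochner_Integration.integral_cong refl) (simp add: space_\<mu> inner_mat_1 trace_row_proj)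
  also have "\<dots> = \<beta> * ?n\<^sup>2 + 2 * \<gamma> * ?n"
    unfolding sq by (simp add: transpose_mat inner_mat_1) (simp add: trace_def mat_def)
  finally have e2: "(real k)\<^sup>2 = \<beta> * ?n\<^sup>2 + 2 * \<gamma> * ?n" .
  \<comment> \<open>For traceless symmetric \<open>A\<close> the variance is exactly
    \<open>c\<close> times the squared norm of \<open>A\<close>.\<close>
  define c where "c = 2 * \<gamma> * ?n\<^sup>2 / (real k)\<^sup>2"
  show ?thesis
  proof (rule that[of c])
    show "0 \<le> c" "CARD('n) = 1 \<Longrightarrow> c = 0" using g by (auto simp: c_def)
    \<comment> \<open>Subtracting \<open>e2\<close> from n times \<open>e1\<close> eliminates
      \<open>\<beta>\<close>.\<close>
    have "?n * real k = ?n\<^sup>2 * \<beta> + ?n\<^sup>2 * (?n + 1) * \<gamma>"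
      by (simp add: e1[symmetric] algebra_simps power2_eq_square)
    then have "?n\<^sup>2 * (?n + 1) * \<gamma> - 2 * \<gamma> * ?n = ?n * real k - (real k)\<^sup>2"
      using e2 by (simp add: mult.commute)
    then have "2 * \<gamma> * (?n * (?n + 1) / 2 - 1) = (?n * real k - (real k)\<^sup>2) / ?n"
      using n by (simp add: field_simps power2_eq_square)
    moreover have "c * D = 2 * \<gamma> * D * ?n\<^sup>2 / (real k)\<^sup>2" for D by (simp add: c_def)
    ultimately have "c * (?n * (?n + 1) / 2 - 1) = ((?n * real k - (real k)\<^sup>2) / ?n) * ?n\<^sup>2 / (real k)\<^sup>2"
      by metis
    also have "\<dots> = ?n\<^sup>2 / real k - ?n"
      using n kp by (simp add: field_simps power2_eq_square)
    finally show "c * (?n * (?n + 1) / 2 - 1) = ?n\<^sup>2 / real k - ?n" .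
  next
    fix A :: "real^'n^'n"
    define s t where "s = ?n / real k" and "t = trace A"
    have sk: "s * (real k / ?n) = 1" using n kp by (simp add: s_def)
    have "(\<integral>U. (s * (row_proj r k U \<bullet> A) - t)\<^sup>2 \<partial>\<mu>)
        = (\<integral>U. s\<^sup>2 * (row_proj r k U \<bullet> A)\<^sup>2 - 2 * s * t * (row_proj r k U \<bullet> A) + t\<^sup>2 \<partial>\<mu>)"
      by (intro Bochner_Integration.integral_cong refl) (simp add: power2_eq_square algebra_simps)
    also have "\<dots> = s\<^sup>2 * (\<integral>U. (row_proj r k U \<bullet> A)\<^sup>2 \<partial>\<mu>)
        - 2 * s * t * (\<integral>U. row_proj r k U \<bullet> A \<partial>\<mu>) + t\<^sup>2"
      by (simp add: integrable_row_proj_inner integrable_row_proj_inner_sq prob_space)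
    also have "\<dots> = s\<^sup>2 * (\<beta> * t\<^sup>2 + \<gamma> * (A \<bullet> A + A \<bullet> transpose A))
        - 2 * t * (s * (real k / ?n)) * t + t\<^sup>2"
      by (simp add: sq expectation_row_proj_inner t_def)
    also have "\<dots> = s\<^sup>2 * \<gamma> * (A \<bullet> A + A \<bullet> transpose A) + (s\<^sup>2 * \<beta> - 1) * t\<^sup>2"
      unfolding sk by (simp add: algebra_simps power2_eq_square)
    also have "\<dots> \<le> s\<^sup>2 * \<gamma> * (2 * (A \<bullet> A)) + 0"
    proof (intro add_mono mult_left_mono mult_nonpos_nonneg)
      show "A \<bullet> A + A \<bullet> transpose A \<le> 2 * (A \<bullet> A)" using inner_transpose_le[of A] by simp
      have "\<beta> * ?n\<^sup>2 \<le> (real k)\<^sup>2" using e2 g n by simp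
      then show "s\<^sup>2 * \<beta> - 1 \<le> 0" using kp by (simp add: s_def power_divide divide_le_eq_1 mult.commute)
    qed (use g in auto)
    also have "\<dots> = c * (norm A)\<^sup>2" by (simp add: c_def s_def power2_norm_eq_inner power_divide)
    finally show "(\<integral>U. (?n / real k * (row_proj r k U \<bullet> A) - trace A)\<^sup>2 \<partial>\<mu>) \<le> c * (norm A)\<^sup>2"
      by (simp add: s_def t_def)
  qed
qed

end


section \<open>Linear estimators and the lower bound on their variance\<close>

text \<open>The queries are prescribed only on points of the product space, so the induction keeps
  the answers in restricted form; at length 0 this is the everywhere \<open>undefined\<close>
  function.\<close>

lemma answers_fixed_queries:
  assumes "\<And>i a. i < k \<Longrightarrow> a \<in> space (\<Pi>\<^sub>M j\<in>{..<i}. borel) \<Longrightarrow> query h i s a = x i"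
    and "m \<le> k"
  shows "answers h A s m = (\<lambda>i\<in>{..<m}. quad_form A (x i))"
  using assms(2)
proof (induction m)
  case (Suc m)
  have IH: "answers h A s m = (\<lambda>i\<in>{..<m}. quad_form A (x i))"
    using Suc by (meson Suc_leD)
  have "answers h A s m \<in> space (\<Pi>\<^sub>M j\<in>{..<m}. borel)"
    by (simp add: IH space_PiM)
  then have "query h m s (answers h A s m) = x m" using Suc.prems by (intro assms) auto
  then show ?case by (auto simp: IH fun_eq_iff less_Suc_eq)
qed (simp add: restrict_def)

text \<open>The witnesses are chosen before \<open>A\<close>: one random matrix serves all
  inputs.\<close>

lemma linear_estimator_outer:
  assumes "linear_estimator k h"
  shows "\<exists>x w. \<forall>A. \<forall>s\<in>space (seed h).
    estimate k h A s = (\<Sum>i<k. w i s *\<^sub>R outer (x i s) (x i s)) \<bullet> A"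
proof -
  obtain x w where
    q: "\<forall>i<k. \<forall>s\<in>space (seed h). \<forall>a\<in>space (\<Pi>\<^sub>M j\<in>{..<i}. borel). query h i s a = x i s" and
    r: "\<forall>s\<in>space (seed h). \<forall>a\<in>space (\<Pi>\<^sub>M j\<in>{..<k}. borel). result h s a = (\<Sum>i<k. w i s * a i)"
    using assms unfolding linear_estimator_def by blast
  show ?thesis
  proof (rule exI[of _ x], rule exI[of _ w], intro allI ballI)
    fix A s assume s: "s \<in> space (seed h)"
    have eq: "answers h A s k = (\<lambda>i\<in>{..<k}. quad_form A (x i s))"
      using q s by (intro answers_fixed_queries[where k = k]) auto
    then have "estimate k h A s = (\<Sum>i<k. w i s * answers h A s k i)"
      unfolding estimate_def using s by (intro r[rule_format]) (auto simp: eq space_PiM)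
    also have "\<dots> = (\<Sum>i<k. w i s *\<^sub>R outer (x i s) (x i s)) \<bullet> A"
      unfolding eq inner_sum_left by (simp add: quad_form_outer)
    finally show "estimate k h A s = (\<Sum>i<k. w i s *\<^sub>R outer (x i s) (x i s)) \<bullet> A" .
  qed
qed

lemma trace_estimator_prob_space: "trace_estimator k h \<Longrightarrow> prob_space (seed h)"
  by (simp add: trace_estimator_def)

lemma estimate_scaleR:
  assumes "linear_estimator k h" "s \<in> space (seed h)"
  shows "estimate k h (c *\<^sub>R A) s = c * estimate k h A s"
proof -
  obtain x w where "\<And>A s. s \<in> space (seed h) \<Longrightarrow>
    estimate k h A s = (\<Sum>i<k. w i s *\<^sub>R outer (x i s) (x i s)) \<bullet> A"
    using linear_estimator_outer[OF assms(1)] by blast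
  then show ?thesis using assms(2) by simp
qed

text \<open>The error is homogeneous in \<open>A\<close>, so the variance scales quadratically.
  Needed because the frame matrices do not have norm 1; unbiasedness supplies measurability of the
  estimate.\<close>

lemma variance_at_le_worst_variance:
  assumes "linear_estimator k h" "unbiased k h"
  shows "variance_at k A h \<le> worst_variance k h * ennreal ((norm A)\<^sup>2)"
proof (cases "A = 0")
  case True
  have "variance_at k A h = (\<integral>\<^sup>+s. 0 \<partial>seed h)"
    unfolding variance_at_def
    using estimate_scaleR[OF assms(1), of _ 0 0] trace_scaleR[of 0 0]
    by (intro nn_integral_cong) (auto simp: True)
  then show ?thesis by simp
next
  case False
  define B where "B = (1 / norm A) *\<^sub>R A"
  have A: "A = norm A *\<^sub>R B" and B: "norm B = 1" using False by (auto simp: B_def)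
  have [measurable]: "estimate k h B \<in> borel_measurable (seed h)"
    using assms(2) unfolding unbiased_def by blast
  have "variance_at k A h = (\<integral>\<^sup>+s. ennreal ((norm A)\<^sup>2) * ennreal ((estimate k h B s - trace B)\<^sup>2) \<partial>seed h)"
    unfolding variance_at_def
  proof (intro nn_integral_cong)
    fix s assume "s \<in> space (seed h)"
    then have "estimate k h A s - trace A = norm A * (estimate k h B s - trace B)"
      using estimate_scaleR[OF assms(1), of s "norm A" B] trace_scaleR[of "norm A" B]
      by (simp add: A[symmetric] right_diff_distrib)
    then show "ennreal ((estimate k h A s - trace A)\<^sup>2)
        = ennreal ((norm A)\<^sup>2) * ennreal ((estimate k h B s - trace B)\<^sup>2)"
      by (simp add: power_mult_distrib flip: ennreal_mult)
  qed
  also have "\<dots> = ennreal ((norm A)\<^sup>2) * variance_at k B h"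
    unfolding variance_at_def by (rule nn_integral_cmult) measurable
  also have "\<dots> \<le> ennreal ((norm A)\<^sup>2) * worst_variance k h"
    unfolding worst_variance_def using B
    by (intro mult_left_mono SUP_upper) (auto simp: frobenius_norm_eq)
  finally show ?thesis by (simp add: mult.commute)
qed

text \<open>\<open>ennreal\<close> sends negative values to 0, so the right side integrates the
  positive part. Needed for a pointwise lower bound that may be negative.\<close>

lemma ennreal_integral_le_nn_integral:
  fixes f :: "'a \<Rightarrow> real"
  assumes "integrable M f"
  shows "ennreal (integral\<^sup>L M f) \<le> (\<integral>\<^sup>+x. ennreal (f x) \<partial>M)"
proof -
  have "integral\<^sup>L M f \<le> (\<integral>x. max 0 (f x) \<partial>M)"
    using assms by (intro integral_mono) auto
  then have "ennreal (integral\<^sup>L M f) \<le> ennreal (\<integral>x. max 0 (f x) \<partial>M)"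
    by (rule ennreal_leI)
  also have "\<dots> = (\<integral>\<^sup>+x. ennreal (max 0 (f x)) \<partial>M)"
    using assms by (intro nn_integral_eq_integral[symmetric]) auto
  also have "\<dots> = (\<integral>\<^sup>+x. ennreal (f x) \<partial>M)"
    by (intro nn_integral_cong) (simp add: max_def ennreal_neg)
  finally show ?thesis .
qed

lemma worst_variance_lower_bound:
  fixes h :: "('s, 'n::finite) query_alg"
  assumes "prob_space (seed h)" "linear_estimator k h" "unbiased k h"
    and k: "1 \<le> k" "k \<le> CARD('n)"
  shows "ennreal ((real CARD('n))\<^sup>2 / real k - real CARD('n))
    \<le> worst_variance k h * ennreal (real CARD('n) * (real CARD('n) + 1) / 2 - 1)"
proof -
  interpret prob_space "seed h" by fact
  let ?n = "real CARD('n)"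
  let ?d = "1 / real k - 1 / ?n"
  \<comment> \<open>The estimate at the identity is the trace of the random matrix; by unbiasedness
    its expectation is n.\<close>
  let ?t = "estimate k h (mat 1)"
  obtain x w where est: "\<And>A s. s \<in> space (seed h) \<Longrightarrow>
    estimate k h A s = (\<Sum>i<k. w i s *\<^sub>R outer (x i s) (x i s)) \<bullet> A"
    using linear_estimator_outer[OF assms(2)] by blast
  have [measurable]: "estimate k h A \<in> borel_measurable (seed h)" for A
    using assms(3) unfolding unbiased_def by blast
  have kp: "real k > 0" and n: "?n > 0" and d: "?d \<ge> 0"
    using k by (auto simp: field_simps)
  have int_t: "integrable (seed h) ?t" "integral\<^sup>L (seed h) ?t = ?n"
    using assms(3) by (auto simp: unbiased_def trace_def mat_def)
  have pt: "?d * (2 * ?n * ?t s - ?n\<^sup>2)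
      \<le> (\<Sum>i\<in>UNIV. \<Sum>j\<in>UNIV. (estimate k h (frame i j) s - trace (frame i j :: real^'n^'n))\<^sup>2)"
    if s: "s \<in> space (seed h)" for s
  proof -
    define M where "M = (\<Sum>i<k. w i s *\<^sub>R outer (x i s) (x i s))"
    have sym: "M $ i $ j = M $ j $ i" for i j
      by (simp add: M_def outer_def mult.commute)
    have t: "?t s = trace M" by (simp add: est[OF s] M_def[symmetric] inner_mat_1)
    \<comment> \<open>The tangent to the square at n bounds it below by a linear function of the
      trace, so its expectation suffices and no square integrability is required.\<close>
    have "0 \<le> (trace M - ?n)\<^sup>2" by simp
    then have "2 * ?n * ?t s - ?n\<^sup>2 \<le> (trace M)\<^sup>2"
      unfolding t power2_diff by (simp add: algebra_simps)
    then have "?d * (2 * ?n * ?t s - ?n\<^sup>2) \<le> ?d * (trace M)\<^sup>2"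
      using d by (rule mult_left_mono)
    also have "\<dots> = (trace M)\<^sup>2 / real k - (trace M)\<^sup>2 / ?n" by (simp add: left_diff_distrib)
    also have "(trace M)\<^sup>2 / real k \<le> M \<bullet> M"
      using trace_sq_le_rank_inner[where k = k and w = "\<lambda>i. w i s" and x = "\<lambda>i. x i s"] kp
      by (simp add: M_def divide_le_eq mult.commute)
    also have "M \<bullet> M - (trace M)\<^sup>2 / ?n = (\<Sum>i\<in>UNIV. \<Sum>j\<in>UNIV. (M \<bullet> frame i j)\<^sup>2)"
      by (rule sum_inner_frame_sq[OF sym, symmetric])
    finally show ?thesis by (simp add: est[OF s] trace_frame M_def)
  qed
  \<comment> \<open>Since the trace has expectation n, the linear bound has expectation
    \<open>?d\<close> times n^2.\<close>
  have "?n\<^sup>2 / real k - ?n = ?d * (2 * ?n * ?n - ?n\<^sup>2)"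
    using n kp by (simp add: field_simps power2_eq_square)
  also have "\<dots> = (\<integral>s. ?d * (2 * ?n * ?t s - ?n\<^sup>2) \<partial>seed h)"
    using int_t by (simp add: prob_space)
  finally have "ennreal (?n\<^sup>2 / real k - ?n) = ennreal (\<integral>s. ?d * (2 * ?n * ?t s - ?n\<^sup>2) \<partial>seed h)"
    by simp
  also have "\<dots> \<le> (\<integral>\<^sup>+s. ennreal (?d * (2 * ?n * ?t s - ?n\<^sup>2)) \<partial>seed h)"
    using int_t by (intro ennreal_integral_le_nn_integral) auto
  also have "\<dots> \<le> (\<integral>\<^sup>+s. ennreal (\<Sum>i\<in>UNIV. \<Sum>j\<in>UNIV.
      (estimate k h (frame i j) s - trace (frame i j :: real^'n^'n))\<^sup>2) \<partial>seed h)"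
    by (intro nn_integral_mono ennreal_leI pt)
  also have "\<dots> = (\<Sum>i\<in>UNIV. \<Sum>j\<in>UNIV. variance_at k (frame i j) h)"
    unfolding variance_at_def
    by (simp add: sum_nonneg nn_integral_sum flip: sum_ennreal)
  also have "\<dots> \<le> (\<Sum>i\<in>UNIV. \<Sum>j\<in>UNIV.
      worst_variance k h * ennreal ((norm (frame i j :: real^'n^'n))\<^sup>2))"
    by (intro sum_mono variance_at_le_worst_variance assms)
  also have "\<dots> = worst_variance k h * ennreal (\<Sum>i\<in>UNIV. \<Sum>j\<in>UNIV. (norm (frame i j :: real^'n^'n))\<^sup>2)"
    by (simp add: sum_nonneg sum_distrib_left flip: sum_ennreal)
  finally show ?thesis unfolding sum_frame_sq .
qed

section \<open>The random orthogonal estimator and its optimality\<close>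

lemma continuous_row [continuous_intros]: "continuous_on S (\<lambda>U :: real^'n^'m. row i U)"
  unfolding row_def by (intro continuous_intros)

lemma estimate_hstar:
  "estimate k (hstar \<mu> r k) A U = real CARD('n) / real k * (row_proj r k U \<bullet> (A :: real^'n^'n))"
proof -
  have "answers (hstar \<mu> r k) A U k = (\<lambda>i\<in>{..<k}. quad_form A (row (r i) U))"
    by (rule answers_fixed_queries) (auto simp: hstar_def)
  then show ?thesis
    by (simp add: estimate_def hstar_def row_proj_def inner_sum_left quad_form_outer)
qed

context haar_orthogonal_measure
begin

lemma measurable_row [measurable]: "row i \<in> borel_measurable \<mu>"
  by (intro measurable_continuous continuous_intros)

lemma trace_estimator_hstar: "trace_estimator k (hstar \<mu> r k)"
proof -
  have [measurable]: "(\<lambda>p. row (r i) (fst p)) \<in> borel_measurable (\<mu> \<Otimes>\<^sub>M (N :: (nat \<Rightarrow> real) measure))" for i N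
    by (rule measurable_compose[OF measurable_fst measurable_row])
  show ?thesis
    unfolding trace_estimator_def hstar_def
    by (simp add: prob_space_axioms case_prod_beta)
qed

lemma linear_estimator_hstar: "linear_estimator k (hstar \<mu> r k)"
  unfolding linear_estimator_def hstar_def
  by (intro exI[of _ "\<lambda>i. row (r i)"] exI[of _ "\<lambda>_ _. real CARD('n) / real k"])
    (simp add: sum_distrib_left)

lemma nonadaptive_hstar: "nonadaptive k (hstar \<mu> r k)"
  by (simp add: nonadaptive_def hstar_def)

lemma unbiased_hstar: "1 \<le> k \<Longrightarrow> unbiased k (hstar \<mu> r k)"
  unfolding unbiased_def estimate_hstar
  by (simp add: hstar_def integrable_row_proj_inner expectation_row_proj_inner)

lemma worst_variance_hstar:
  assumes "inj_on r {..<k}" "1 \<le> k"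
  obtains c where "0 \<le> c" "CARD('n) = 1 \<Longrightarrow> c = 0"
    "c * (real CARD('n) * (real CARD('n) + 1) / 2 - 1) = (real CARD('n))\<^sup>2 / real k - real CARD('n)"
    "worst_variance k (hstar \<mu> r k) \<le> ennreal c"
proof -
  obtain c where c: "0 \<le> c" "CARD('n) = 1 \<Longrightarrow> c = 0"
    "c * (real CARD('n) * (real CARD('n) + 1) / 2 - 1) = (real CARD('n))\<^sup>2 / real k - real CARD('n)"
    and le: "\<And>A. (\<integral>U. (real CARD('n) / real k * (row_proj r k U \<bullet> A) - trace A)\<^sup>2 \<partial>\<mu>) \<le> c * (norm A)\<^sup>2"
    by (rule row_proj_variance[OF assms], rule that) blast+
  have "worst_variance k (hstar \<mu> r k) \<le> ennreal c"
    unfolding worst_variance_def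
  proof (rule SUP_least)
    fix A :: "real^'n^'n" assume "A \<in> {A. frobenius_norm A = 1}"
    then have A: "norm A = 1" by (simp add: frobenius_norm_eq)
    have "integrable \<mu> (\<lambda>U. (real CARD('n) / real k * (row_proj r k U \<bullet> A) - trace A)\<^sup>2)"
      unfolding power2_diff power_mult_distrib
      by (intro Bochner_Integration.integrable_add Bochner_Integration.integrable_diff
          integrable_mult_right integrable_mult_left integrable_const
          integrable_row_proj_inner integrable_row_proj_inner_sq)
    then have "variance_at k A (hstar \<mu> r k)
        = ennreal (\<integral>U. (real CARD('n) / real k * (row_proj r k U \<bullet> A) - trace A)\<^sup>2 \<partial>\<mu>)"
      unfolding variance_at_def estimate_hstar
      by (subst nn_integral_eq_integral[symmetric]) (auto simp: hstar_def)
    also have "\<dots> \<le> ennreal c" using le[of A] A by (intro ennreal_leI) simp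
    finally show "variance_at k A (hstar \<mu> r k) \<le> ennreal c" .
  qed
  then show ?thesis using that c by blast
qed

lemma worst_variance_hstar_le:
  fixes h :: "('s, 'n) query_alg"
  assumes r: "inj_on r {..<k}" and k: "1 \<le> k" "k \<le> CARD('n)"
    and h: "prob_space (seed h)" "linear_estimator k h" "unbiased k h"
  shows "worst_variance k (hstar \<mu> r k) \<le> worst_variance k h"
proof -
  let ?n = "real CARD('n)"
  let ?D = "?n * (?n + 1) / 2 - 1"
  obtain c where c: "0 \<le> c" "CARD('n) = 1 \<Longrightarrow> c = 0" "c * ?D = ?n\<^sup>2 / real k - ?n"
    and le: "worst_variance k (hstar \<mu> r k) \<le> ennreal c"
    by (rule worst_variance_hstar[OF r k(1)], rule that) blast+
  have "ennreal c \<le> worst_variance k h"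
  \<comment> \<open>For n = 1 the dimension \<open>?D\<close> is 0 and cannot be cancelled, but then
    \<open>c\<close> is 0; an infinite worst variance is trivial.\<close>
  proof (cases "CARD('n) = 1 \<or> worst_variance k h = \<top>")
    case True
    then show ?thesis using c(2) by auto
  next
    case False
    then obtain v where v: "worst_variance k h = ennreal v" "0 \<le> v"
      by (metis ennreal_cases)
    have "2 \<le> CARD('n)" using False zero_less_card_finite[where 'a = 'n] by linarith
    then have "2 * 3 \<le> ?n * (?n + 1)" by (intro mult_mono) auto
    then have D: "?D > 0" by simp
    \<comment> \<open>By \<open>c(3)\<close> the general lower bound is \<open>c * ?D\<close>, so
      cancelling the positive \<open>?D\<close> compares \<open>c\<close> with the worst
      variance.\<close>
    have "ennreal (c * ?D) \<le> ennreal (v * ?D)"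
      using worst_variance_lower_bound[OF h k] D v by (simp add: c(3) ennreal_mult)
    then have "c * ?D \<le> v * ?D" using v(2) D by (subst (asm) ennreal_le_iff) auto
    then show ?thesis using D v by (simp add: ennreal_leI)
  qed
  with le show ?thesis by (rule order_trans)
qed

end

theorem theorem1:
  fixes \<mu> :: "(real^'n^'n) measure" and r :: "nat \<Rightarrow> 'n" and k :: nat
  assumes "1 \<le> k" and "k \<le> CARD('n)"
    and "haar_orthogonal \<mu>"
    and "inj_on r {..<k}"
  shows "trace_estimator k (hstar \<mu> r k) \<and>
         linear_estimator k (hstar \<mu> r k) \<and>
         nonadaptive k (hstar \<mu> r k) \<and>
         unbiased k (hstar \<mu> r k) \<and>
         (\<forall>h :: ('s, 'n) query_alg.
            trace_estimator k h \<and> linear_estimator k h \<and> nonadaptive k h \<and> unbiased k h \<longrightarrow>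
            worst_variance k (hstar \<mu> r k) \<le> worst_variance k h)"
proof -
  interpret haar_orthogonal_measure \<mu>
    using assms(3) by (simp add: haar_orthogonal_iff)
  show ?thesis
    using assms trace_estimator_hstar linear_estimator_hstar nonadaptive_hstar unbiased_hstar
      worst_variance_hstar_le trace_estimator_prob_space by blast
qed

end
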